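(* Let $k>1$, $A=\mathbb{Z}_3^k$, and let $T$ be a caterpillar with spine path $s_1s_2s_3$ and $|V(T)|=3^k$, where $X,Y,Z$ are the sets of leaves attached to $s_1,s_2,s_3$ respectively. Then $T$ is $A$-rainbow if and only if none of the following holds: 1. $|X|\equiv0\pmod 3$ and $|Z|\equiv2\pmod 3$, or $|X|\equiv2\pmod3$ and $|Z|\equiv0\pmod3$; 2. $|Y|=0$ and either ($|X|\equiv1\pmod3$ and $|Z|\equiv2\pmod3$) or ($|X|\equiv2\pmod3$ and $|Z|\equiv1\pmod3$).
   Context: For an Abelian group $A$ and a tree $T$ with $|V(T)|=|A|$, a labeling $f\colon V(T)\to A$ induces the edge labeling $uv\mapsto f(u)+f(v)$. $f$ is an $A$-rainbow labeling if $f$ is a bijection and all edges receive distinct labels; $T$ is $A$-rainbow if it admits such a labeling. *)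

theory Defs
  imports "HOL-Analysis.Finite_Cartesian_Product" "HOL-Library.Numeral_Type"
begin

text \<open>A graph is given by a finite vertex set \<open>V\<close> and a set \<open>E\<close> of two-element subsets of \<open>V\<close>.\<close>

definition simple_graph :: "'v set \<Rightarrow> 'v set set \<Rightarrow> bool" where
  "simple_graph V E \<longleftrightarrow> finite V \<and> (\<forall>e\<in>E. e \<subseteq> V \<and> card e = 2)"

definition walk :: "'v set \<Rightarrow> 'v set set \<Rightarrow> 'v list \<Rightarrow> bool" where
  "walk V E p \<longleftrightarrow>
     p \<noteq> [] \<and> set p \<subseteq> V \<and> (\<forall>i. Suc i < length p \<longrightarrow> {p ! i, p ! Suc i} \<in> E)"

definition simple_path :: "'v set \<Rightarrow> 'v set set \<Rightarrow> 'v list \<Rightarrow> bool" where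
  "simple_path V E p \<longleftrightarrow> walk V E p \<and> distinct p"

definition connected_graph :: "'v set \<Rightarrow> 'v set set \<Rightarrow> bool" where
  "connected_graph V E \<longleftrightarrow>
     V \<noteq> {} \<and> (\<forall>u\<in>V. \<forall>v\<in>V. \<exists>p. walk V E p \<and> hd p = u \<and> last p = v)"

definition graph_cycle :: "'v set \<Rightarrow> 'v set set \<Rightarrow> 'v list \<Rightarrow> bool" where
  "graph_cycle V E p \<longleftrightarrow> simple_path V E p \<and> 3 \<le> length p \<and> {last p, hd p} \<in> E"

definition tree :: "'v set \<Rightarrow> 'v set set \<Rightarrow> bool" where
  "tree V E \<longleftrightarrow> simple_graph V E \<and> connected_graph V E \<and> (\<nexists>p. graph_cycle V E p)"

definition leaf :: "'v set \<Rightarrow> 'v set set \<Rightarrow> 'v \<Rightarrow> bool" where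
  "leaf V E v \<longleftrightarrow> v \<in> V \<and> card {e \<in> E. v \<in> e} = 1"

text \<open>The end vertices of the spine are allowed to carry no leaves, that is, to be leaves of the
  tree themselves; the case where the spine consists of all the non-leaves is included.\<close>

definition caterpillar_with_spine :: "'v set \<Rightarrow> 'v set set \<Rightarrow> 'v list \<Rightarrow> bool" where
  "caterpillar_with_spine V E p \<longleftrightarrow>
     tree V E \<and> simple_path V E p \<and>
     (\<forall>v \<in> V - set p. leaf V E v \<and> (\<exists>s \<in> set p. {s, v} \<in> E))"

definition leaves_attached :: "'v set \<Rightarrow> 'v set set \<Rightarrow> 'v list \<Rightarrow> 'v \<Rightarrow> 'v set" where
  "leaves_attached V E p s = {v \<in> V - set p. leaf V E v \<and> {s, v} \<in> E}"

text \<open>For an edge \<open>{u, v}\<close> with \<open>u \<noteq> v\<close> the induced label \<open>sum f {u, v}\<close> is \<open>f u + f v\<close>. The Abelian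
  group is the whole type \<open>'a\<close>.\<close>

definition rainbow_labeling ::
    "'v set \<Rightarrow> 'v set set \<Rightarrow> ('v \<Rightarrow> 'a::{finite,ab_group_add}) \<Rightarrow> bool" where
  "rainbow_labeling V E f \<longleftrightarrow> bij_betw f V UNIV \<and> inj_on (\<lambda>e. sum f e) E"

definition rainbow :: "'a::{finite,ab_group_add} itself \<Rightarrow> 'v set \<Rightarrow> 'v set set \<Rightarrow> bool" where
  "rainbow A V E \<longleftrightarrow> (\<exists>f :: 'v \<Rightarrow> 'a. rainbow_labeling V E f)"

text \<open>The numeral type \<open>3\<close> is the ring of integers modulo 3, so \<open>3 ^ 'k\<close> with componentwise addition
  is the direct power of \<open>CARD('k)\<close> copies of the cyclic group of order 3.\<close>

type_synonym 'k Z3_power = "3 ^ 'k"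

end

theory Submission
  imports Defs "HOL-Library.Product_Plus"
begin

text \<open>
  Translating a labeling, let the middle spine vertex have label \<open>0\<close> and the outer ones labels \<open>a\<close>
  and \<open>c\<close>. Let \<open>P\<close> and \<open>R\<close> be the label sets of \<open>X\<close> and \<open>Z\<close>. Leaves of the middle vertex give edge
  labels equal to their own labels, so the labeling is rainbow iff \<open>P + a\<close> and \<open>R + c\<close> are disjoint
  subsets of \<open>P \<union> R \<union> {0}\<close>: then the steps by \<open>a\<close> from \<open>P\<close> and by \<open>c\<close> from \<open>R\<close> form directed cycles
  and one path that ends in \<open>0\<close>. Summing all elements, the path starts in \<open>- |X| a - |Z| c\<close>, which has
  to differ from \<open>a\<close> and \<open>c\<close>; this gives the first obstruction. If \<open>Y\<close> is empty and \<open>c \<noteq> - a\<close>, both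
  \<open>c - a\<close> and \<open>a - c\<close> are forced to step to \<open>- a - c\<close>, which gives the second.

  For the construction, if \<open>|X|\<close> and \<open>|Z|\<close> agree modulo 3, take \<open>c = - a\<close> and fill cosets of
  \<open>\<langle>a\<rangle>\<close> with triangles of one kind and with 2-cycles. Otherwise take \<open>a\<close> and \<open>c\<close> independent, put a
  short path inside \<open>\<langle>a, c\<rangle>\<close>, and fill the other cosets of \<open>\<langle>a, c\<rangle>\<close>; a coset can be filled with
  \<open>3i\<close> steps \<open>a\<close> and \<open>3j\<close> steps \<open>c\<close> whenever \<open>i + j \<le> 3\<close>.
\<close>

section \<open>Step pairs: definitions, symmetry, gluing and transport along homomorphisms\<close>

text \<open>From a point of \<open>P\<close> one steps by \<open>a\<close>, from a point of \<open>R\<close> by \<open>c\<close>; walks may stop only in \<open>T\<close>.\<close>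

definition step_pair :: "'a::ab_group_add \<Rightarrow> 'a \<Rightarrow> 'a set \<Rightarrow> 'a set \<Rightarrow> 'a set \<Rightarrow> bool" where
  "step_pair a c T P R \<longleftrightarrow>
     P \<inter> R = {} \<and> (+) a ` P \<inter> (+) c ` R = {} \<and> (+) a ` P \<union> (+) c ` R \<subseteq> P \<union> R \<union> T"

text \<open>With no stopping points the steps permute a finite \<open>P \<union> R\<close>, so
  \<open>i\<close> and \<open>j\<close> count the steps by \<open>a\<close> and by \<open>c\<close>
  in a union of directed cycles.\<close>

definition closed_counts :: "'a::ab_group_add \<Rightarrow> 'a \<Rightarrow> nat \<Rightarrow> nat \<Rightarrow> bool" where
  "closed_counts a c i j \<longleftrightarrow> (\<exists>P R. step_pair a c {} P R \<and> card P = i \<and> card R = j)"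

text \<open>\<open>0\<close>, \<open>a\<close>, \<open>c\<close> are the spine labels. The leaves of
  the middle vertex do not appear: they get all remaining labels, and \<open>T = {0}\<close> keeps
  the steps off those labels.\<close>

definition rooted_counts :: "'a::ab_group_add \<Rightarrow> 'a \<Rightarrow> nat \<Rightarrow> nat \<Rightarrow> bool" where
  "rooted_counts a c x z \<longleftrightarrow> a \<noteq> 0 \<and> c \<noteq> 0 \<and> a \<noteq> c \<and>
     (\<exists>P R. step_pair a c {0} P R \<and> (P \<union> R) \<inter> {0, a, c} = {} \<and> card P = x \<and> card R = z)"

lemma step_pair_commute: "step_pair a c T P R \<longleftrightarrow> step_pair c a T R P"
  unfolding step_pair_def by blast

lemma rooted_counts_commute: "rooted_counts a c x z \<longleftrightarrow> rooted_counts c a z x"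
proof -
  have "rooted_counts c a z x" if rooted: "rooted_counts a c x z" for a c :: 'a and x z
  proof -
    obtain P R where "step_pair a c {0} P R" "(P \<union> R) \<inter> {0, a, c} = {}" "card P = x" "card R = z"
      using rooted unfolding rooted_counts_def by auto
    then have "step_pair c a {0} R P" "(R \<union> P) \<inter> {0, c, a} = {}" "card R = z" "card P = x"
      by (simp_all add: step_pair_commute[of c] Un_commute insert_commute)
    then show ?thesis using rooted unfolding rooted_counts_def by auto
  qed
  then show ?thesis by blast
qed

text \<open>Each image stays on its own side of the disjointness assumption, so gluing creates no
  collision; \<open>T\<close> belongs to the first side because walks there may end in it.\<close>

lemma step_pair_Un:
  assumes "step_pair a c T P R" "step_pair a c {} P' R'"
    and "(P \<union> R \<union> T) \<inter> (P' \<union> R') = {}"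
  shows "step_pair a c T (P \<union> P') (R \<union> R')"
proof -
  let ?A = "(+) a ` P" and ?A' = "(+) a ` P'" and ?C = "(+) c ` R" and ?C' = "(+) c ` R'"
  have 1: "P \<inter> R = {}" "?A \<inter> ?C = {}" "?A \<union> ?C \<subseteq> P \<union> R \<union> T"
    and 2: "P' \<inter> R' = {}" "?A' \<inter> ?C' = {}" "?A' \<union> ?C' \<subseteq> P' \<union> R'"
    using assms(1,2) by (simp_all add: step_pair_def)
  from 1(3) 2(3) assms(3) have "(?A \<union> ?C) \<inter> (?A' \<union> ?C') = {}" by (metis Int_mono subset_empty)
  then have "?A \<inter> ?C' = {}" "?A' \<inter> ?C = {}" by (simp_all add: Int_Un_distrib Int_Un_distrib2 Int_commute)
  then have "(?A \<union> ?A') \<inter> (?C \<union> ?C') = {}"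
    using 1(2) 2(2) by (simp add: Int_Un_distrib Int_Un_distrib2)
  moreover have "(P \<union> P') \<inter> (R \<union> R') = {}" using 1(1) 2(1) assms(3) by auto
  moreover have "?A \<union> ?A' \<union> (?C \<union> ?C') \<subseteq> P \<union> P' \<union> (R \<union> R') \<union> T"
    using 1(3) 2(3) by auto
  ultimately show ?thesis unfolding step_pair_def image_Un by simp
qed

lemma step_pair_image:
  fixes g :: "'h::ab_group_add \<Rightarrow> 'a::ab_group_add"
  assumes add: "\<And>u v. g (u + v) = g u + g v" and "inj g" and "step_pair a c T P R"
  shows "step_pair (g a) (g c) ((\<lambda>u. w + g u) ` T) ((\<lambda>u. w + g u) ` P) ((\<lambda>u. w + g u) ` R)"
proof -
  let ?h = "\<lambda>u. w + g u"
  have "inj ?h" using \<open>inj g\<close> by (auto simp: inj_def)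
  moreover have "(+) (g d) ` ?h ` S = ?h ` (+) d ` S" for d S
    by (simp add: image_image add add.left_commute)
  ultimately show ?thesis
    using assms(3) unfolding step_pair_def
    by (simp add: image_Int[symmetric] image_Un[symmetric] image_mono)
qed

section \<open>Filling cosets of a subgroup with cycles\<close>

text \<open>\<open>W\<close> is a union of cosets of \<open>range g\<close>. Each entry of
  \<open>ps\<close> consumes one coset, which receives a translated copy of its cycles; the rest of
  \<open>W\<close> stays invariant, and the size bound leaves a coset for every entry.\<close>

lemma fill_invariant_set:
  fixes g :: "'h::{finite,ab_group_add} \<Rightarrow> 'a::{finite,ab_group_add}"
  assumes add: "\<And>u v. g (u + v) = g u + g v" and "inj g"
    and "\<And>p. p \<in> set ps \<Longrightarrow> closed_counts a c (fst p) (snd p)"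
    and "\<And>w u. w \<in> W \<Longrightarrow> w + g u \<in> W"
    and "length ps * CARD('h) \<le> card W"
  shows "\<exists>P R. step_pair (g a) (g c) {} P R \<and> P \<union> R \<subseteq> W \<and>
    card P = sum_list (map fst ps) \<and> card R = sum_list (map snd ps)"
  using assms(3-)
proof (induction ps arbitrary: W)
  case Nil
  show ?case by (intro exI[of _ "{}"]) (simp add: step_pair_def)
next
  case (Cons p ps)
  have "card W \<noteq> 0" using Cons.prems(3) by (auto simp: card_gt_0_iff)
  then obtain w where w: "w \<in> W" by fastforce
  define h where "h u = w + g u" for u
  have inj: "inj h" using \<open>inj g\<close> by (auto simp: inj_def h_def)
  have hW: "range h \<subseteq> W" using Cons.prems(2) w by (auto simp: h_def)
  have gd: "g (u - v) = g u - g v" for u v using add[of "u - v" v] by (simp add: algebra_simps)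
  have "card (W - range h) = card W - CARD('h)"
    using hW inj by (simp add: card_Diff_subset card_image)
  then have le: "length ps * CARD('h) \<le> card (W - range h)" using Cons.prems(3) by simp
  have inv: "v + g u \<in> W - range h" if "v \<in> W - range h" for v u
  proof -
    have "v + g u \<notin> range h"
    proof
      assume "v + g u \<in> range h"
      then obtain t where "v + g u = w + g t" by (auto simp: h_def)
      then have "v = h (t - u)" by (simp add: h_def gd algebra_simps)
      then show False using that by auto
    qed
    then show ?thesis using that Cons.prems(2) by auto
  qed
  obtain P R where PR: "step_pair (g a) (g c) {} P R" "P \<union> R \<subseteq> W - range h"
    "card P = sum_list (map fst ps)" "card R = sum_list (map snd ps)"
    using Cons.IH[OF _ inv le] Cons.prems(1) by auto
  obtain P' R' where PR': "step_pair a c {} P' R'" "card P' = fst p" "card R' = snd p"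
    using Cons.prems(1)[of p] unfolding closed_counts_def by auto
  have st: "step_pair (g a) (g c) {} (h ` P') (h ` R')"
    using step_pair_image[OF add \<open>inj g\<close> PR'(1), of w] by (simp add: h_def)
  have "step_pair (g a) (g c) {} (P \<union> h ` P') (R \<union> h ` R')"
    using PR(1,2) st by (intro step_pair_Un) auto
  moreover have "card (P \<union> h ` P') = sum_list (map fst (p # ps))"
    "card (R \<union> h ` R') = sum_list (map snd (p # ps))"
  proof -
    have "P \<inter> h ` P' = {}" "R \<inter> h ` R' = {}" using PR(2) by auto
    then show "card (P \<union> h ` P') = sum_list (map fst (p # ps))"
      "card (R \<union> h ` R') = sum_list (map snd (p # ps))"
      using PR(3,4) PR'(2,3)
      by (simp_all add: card_Un_disjoint card_image inj_on_subset[OF inj])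
  qed
  moreover have "P \<union> h ` P' \<union> (R \<union> h ` R') \<subseteq> W" using PR(2) hW by auto
  ultimately show ?case by blast
qed

text \<open>The rooted pattern lives in the subgroup \<open>range g\<close>, the closed ones in
  further cosets; \<open>Suc\<close> pays for the subgroup. Points left over stay free for the
  leaves of the middle vertex.\<close>

lemma rooted_counts_extend:
  fixes g :: "'h::{finite,ab_group_add} \<Rightarrow> 'a::{finite,ab_group_add}"
  assumes add: "\<And>u v. g (u + v) = g u + g v" and "inj g"
    and root: "rooted_counts a c x z"
    and "\<And>p. p \<in> set ps \<Longrightarrow> closed_counts a c (fst p) (snd p)"
    and "Suc (length ps) * CARD('h) \<le> CARD('a)"
  shows "rooted_counts (g a) (g c) (x + sum_list (map fst ps)) (z + sum_list (map snd ps))"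
proof -
  have g0: "g 0 = 0" using add[of 0 0] by simp
  have gd: "g (u - v) = g u - g v" for u v using add[of "u - v" v] by (simp add: algebra_simps)
  have "card (UNIV - range g) = CARD('a) - CARD('h)"
    using \<open>inj g\<close> by (simp add: card_Diff_subset card_image)
  then have le: "length ps * CARD('h) \<le> card (UNIV - range g)" using assms(5) by simp
  have inv: "v + g u \<in> UNIV - range g" if "v \<in> UNIV - range g" for v u
  proof -
    have "v = g (t - u)" if "v + g u = g t" for t using that by (simp add: gd algebra_simps)
    then show ?thesis using that by blast
  qed
  obtain P' R' where PR': "step_pair (g a) (g c) {} P' R'" "P' \<union> R' \<subseteq> UNIV - range g"
    "card P' = sum_list (map fst ps)" "card R' = sum_list (map snd ps)"
    using fill_invariant_set[OF add \<open>inj g\<close> assms(4) inv le] by blast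
  obtain P R where PR: "step_pair a c {0} P R" "(P \<union> R) \<inter> {0, a, c} = {}" "card P = x" "card R = z"
    and ne: "a \<noteq> 0" "c \<noteq> 0" "a \<noteq> c"
    using root unfolding rooted_counts_def by blast
  have st: "step_pair (g a) (g c) {0} (g ` P) (g ` R)"
    using step_pair_image[OF add \<open>inj g\<close> PR(1), of 0] by (simp add: g0)
  have "step_pair (g a) (g c) {0} (g ` P \<union> P') (g ` R \<union> R')"
    using PR'(1,2) st g0[symmetric] by (intro step_pair_Un) auto
  moreover have "card (g ` P \<union> P') = x + sum_list (map fst ps)"
    "card (g ` R \<union> R') = z + sum_list (map snd ps)"
  proof -
    have "g ` P \<inter> P' = {}" "g ` R \<inter> R' = {}" using PR'(2) by auto
    then show "card (g ` P \<union> P') = x + sum_list (map fst ps)"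
      "card (g ` R \<union> R') = z + sum_list (map snd ps)"
      using PR'(3,4) PR(3,4) \<open>inj g\<close>
      by (simp_all add: card_Un_disjoint card_image inj_on_subset[OF \<open>inj g\<close>])
  qed
  moreover have "(g ` P \<union> P' \<union> (g ` R \<union> R')) \<inter> {0, g a, g c} = {}"
  proof -
    have "(g ` P \<union> g ` R) \<inter> g ` {0, a, c} = {}"
      using PR(2) \<open>inj g\<close> by (metis image_Int image_Un image_empty)
    then show ?thesis using PR'(2) g0 by auto
  qed
  moreover have "g a \<noteq> 0" "g c \<noteq> 0" "g a \<noteq> g c"
    using ne \<open>inj g\<close> g0 by (metis injD)+
  ultimately show ?thesis unfolding rooted_counts_def by blast
qed

section \<open>Building blocks in the group of order 3 and in its square\<close>

lemma Z3_numerals: "(3::3) = 0" "(4::3) = 1"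
  by simp_all

lemma Z3_triple: "v + v + v = (0::3)"
proof -
  have "v + v + v = 3 * v" by (simp add: algebra_simps)
  then show ?thesis by (simp only: Z3_numerals mult_zero_left)
qed

text \<open>Since \<open>2\<close> is \<open>- 1\<close>, there are a triangle in each direction and
  the 2-cycle that steps by \<open>1\<close> and back.\<close>

lemma closed_counts_Z3:
  "closed_counts (1::3) 2 3 0" "closed_counts (1::3) 2 0 3" "closed_counts (1::3) 2 1 1"
proof -
  note [simp] = Z3_numerals
  show "closed_counts (1::3) 2 3 0" unfolding closed_counts_def
    by (rule exI[of _ "UNIV"], rule exI[of _ "{}"]) (simp add: step_pair_def)
  show "closed_counts (1::3) 2 0 3" unfolding closed_counts_def
    by (rule exI[of _ "{}"], rule exI[of _ "UNIV"]) (simp add: step_pair_def)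
  show "closed_counts (1::3) 2 1 1" unfolding closed_counts_def
    by (rule exI[of _ "{0}"], rule exI[of _ "{1}"]) (simp add: step_pair_def)
qed

text \<open>The spine labels exhaust the group, and the path to \<open>0\<close> has no
  steps.\<close>

lemma rooted_counts_Z3: "rooted_counts (1::3) 2 0 0"
  unfolding rooted_counts_def by (auto simp: step_pair_def)

text \<open>Counts \<open>(3, 3)\<close> come from the closed walk \<open>a, a, c, a, c, c\<close>. If \<open>i + j = 3\<close> with \<open>i, j > 0\<close>, one
  lets all points with the same coordinate sum take the same step.\<close>

lemma closed_counts_Z3_square:
  assumes "i + j \<le> 3"
  shows "closed_counts (1 :: 3, 0 :: 3) (0, 1) (3 * i) (3 * j)"
proof -
  note [simp] = Z3_numerals
  have rows: "\<exists>J::3 set. card J = n" if "n \<le> 3" for n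
    using obtain_subset_with_card_n[of n "UNIV::3 set"] that by auto
  consider "j = 0" | "i = 0" | "i = 1" "j = 1" | "i = 1" "j = 2" | "i = 2" "j = 1"
    using assms by linarith
  then show ?thesis
  proof cases
    case 1
    then obtain J :: "3 set" where "card J = i" using rows assms by auto
    moreover have "step_pair (1 :: 3, 0 :: 3) (0, 1) {} (UNIV \<times> J) {}"
      by (auto simp: step_pair_def)
    ultimately show ?thesis using 1 unfolding closed_counts_def
      by (intro exI conjI) (auto simp: card_cartesian_product)
  next
    case 2
    then obtain J :: "3 set" where "card J = j" using rows assms by auto
    moreover have "step_pair (1 :: 3, 0 :: 3) (0, 1) {} {} (J \<times> UNIV)"
      by (auto simp: step_pair_def)
    ultimately show ?thesis using 2 unfolding closed_counts_def
      by (intro exI conjI) (auto simp: card_cartesian_product)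
  next
    case 3
    then show ?thesis unfolding closed_counts_def
      by (intro exI[of _ "{(0, 0), (1, 0), (2, 1)}"] exI[of _ "{(2, 0), (0, 1), (0, 2)}"])
        (simp add: step_pair_def)
  next
    case 4
    then show ?thesis unfolding closed_counts_def
      by (intro exI[of _ "{(0, 0), (1, 2), (2, 1)}"]
          exI[of _ "{(0, 1), (1, 0), (2, 2), (0, 2), (2, 0), (1, 1)}"]) (simp add: step_pair_def)
  next
    case 5
    then show ?thesis unfolding closed_counts_def
      by (intro exI[of _ "{(0, 1), (1, 0), (2, 2), (0, 2), (2, 0), (1, 1)}"]
          exI[of _ "{(0, 0), (1, 2), (2, 1)}"]) (simp add: step_pair_def)
  qed
qed

text \<open>The paths are \<open>c\<close>; \<open>c\<close> together with a triangle; \<open>a, a, c, a\<close>; and \<open>c, a, c\<close>.\<close>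

lemma rooted_counts_Z3_square:
  shows "rooted_counts (1 :: 3, 0 :: 3) (0, 1) 0 1" "rooted_counts (1 :: 3, 0 :: 3) (0, 1) 0 4"
    "rooted_counts (1 :: 3, 0 :: 3) (0, 1) 3 1" "rooted_counts (1 :: 3, 0 :: 3) (0, 1) 1 2"
proof -
  note [simp] = Z3_numerals
  note [simp] = zero_prod_def step_pair_def
  show "rooted_counts (1 :: 3, 0 :: 3) (0, 1) 0 1" unfolding rooted_counts_def
    by (intro conjI exI[of _ "{}"] exI[of _ "{(0,2)}"]) simp_all
  show "rooted_counts (1 :: 3, 0 :: 3) (0, 1) 0 4" unfolding rooted_counts_def
    by (intro conjI exI[of _ "{}"] exI[of _ "{(0,2),(2,0),(2,1),(2,2)}"]) simp_all
  show "rooted_counts (1 :: 3, 0 :: 3) (0, 1) 3 1" unfolding rooted_counts_def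
    by (intro conjI exI[of _ "{(0,2),(1,2),(2,0)}"] exI[of _ "{(2,2)}"]) simp_all
  show "rooted_counts (1 :: 3, 0 :: 3) (0, 1) 1 2" unfolding rooted_counts_def
    by (intro conjI exI[of _ "{(2,2)}"] exI[of _ "{(2,1),(0,2)}"]) simp_all
qed

section \<open>The two obstructions\<close>

lemma sum_const_mod_3:
  fixes a :: "'a::ab_group_add"
  assumes "a + a + a = 0" and "finite P"
  shows "(\<Sum>v\<in>P. a) = (\<Sum>i<card P mod 3. a)"
proof -
  have "(\<Sum>i<n. a) = (\<Sum>i<n mod 3. a)" for n :: nat
  proof (induction n rule: less_induct)
    case (less n)
    show ?case
    proof (cases "n < 3")
      case False
      define m where "m = n - 3"
      then have n: "n = Suc (Suc (Suc m))" using False by simp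
      have "(\<Sum>i<n. a) = (\<Sum>i<m. a)" using assms(1) by (simp add: n add.assoc)
      also have "\<dots> = (\<Sum>i<m mod 3. a)" using less[of m] n by simp
      also have "m mod 3 = n mod 3" using False by (simp add: m_def le_mod_geq)
      finally show ?thesis .
    qed simp
  qed
  moreover have "(\<Sum>v\<in>P. a) = (\<Sum>i<card P. a)"
    using assms(2) by (induction P) (auto simp: add.commute)
  ultimately show ?thesis by simp
qed

text \<open>\<open>m\<close> is the start of the path to \<open>0\<close>: the steps are injective
  and miss exactly one point of \<open>insert 0 (P \<union> R)\<close>. Comparing the sum of this
  set with the sum of the images gives the equation.\<close>

lemma step_pair_root_image:
  fixes P R :: "'a::{finite,ab_group_add} set"
  assumes "step_pair a c {0} P R" and "0 \<notin> P \<union> R"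
  obtains m where "m \<in> insert 0 (P \<union> R)" and "m + (\<Sum>v\<in>P. a) + (\<Sum>v\<in>R. c) = 0"
proof -
  let ?I = "(+) a ` P \<union> (+) c ` R" and ?S = "insert 0 (P \<union> R)"
  have disj: "P \<inter> R = {}" "(+) a ` P \<inter> (+) c ` R = {}" and sub: "?I \<subseteq> ?S"
    using assms(1) by (auto simp: step_pair_def)
  have "card ?S = Suc (card ?I)"
    using assms(2) disj by (simp add: card_Un_disjoint card_image)
  then have "card (?S - ?I) = 1" using sub by (simp add: card_Diff_subset)
  then obtain m where m: "?S - ?I = {m}" by (meson card_1_singletonE)
  have "sum id P + sum id R = sum id ?S"
    using assms(2) disj by (simp add: sum.union_disjoint)
  also have "\<dots> = sum id (?S - ?I) + sum id ?I" using sub by (simp add: sum.subset_diff)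
  also have "sum id ?I = (\<Sum>v\<in>P. a + v) + (\<Sum>v\<in>R. c + v)"
    using disj by (simp add: sum.union_disjoint sum.reindex)
  also have "\<dots> = (\<Sum>v\<in>P. a) + (\<Sum>v\<in>R. c) + (sum id P + sum id R)"
    by (simp add: sum.distrib algebra_simps)
  finally have "m + (\<Sum>v\<in>P. a) + (\<Sum>v\<in>R. c) = 0" unfolding m by (simp add: algebra_simps)
  then show ?thesis using m that by blast
qed

text \<open>The path would have to start in \<open>- (c + c) = c\<close>, a spine label, which lies
  outside \<open>insert 0 (P \<union> R)\<close>.\<close>

lemma rooted_counts_not_0_2:
  fixes a c :: "'a::{finite,ab_group_add}"
  assumes three: "\<And>v :: 'a. v + v + v = 0" and "rooted_counts a c x z"
    and "x mod 3 = 0" "z mod 3 = 2"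
  shows False
proof -
  obtain P R where PR: "step_pair a c {0} P R" "(P \<union> R) \<inter> {0, a, c} = {}" "card P = x" "card R = z"
    and ne: "c \<noteq> 0" using assms(2) unfolding rooted_counts_def by blast
  have "(\<Sum>v\<in>P. a) = 0" "(\<Sum>v\<in>R. c) = c + c"
    using sum_const_mod_3[OF three, of P a] sum_const_mod_3[OF three, of R c] PR assms
    by (simp_all add: numeral_2_eq_2)
  moreover obtain m where "m \<in> insert 0 (P \<union> R)" "m + (\<Sum>v\<in>P. a) + (\<Sum>v\<in>R. c) = 0"
    using step_pair_root_image[OF PR(1)] PR(2) by auto
  moreover have "c + (c + c) = 0" using three by (simp add: add.assoc)
  ultimately have "c \<in> insert 0 (P \<union> R)" by (metis add_right_cancel add.right_neutral)
  then show False using PR(2) ne by auto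
qed

text \<open>All labels are spent on the spine and the outer leaves. If \<open>c = - a\<close>, the
  path would start in \<open>c - a = a\<close>; otherwise two forced steps collide in
  \<open>- a - c\<close>.\<close>

lemma rooted_counts_spanning_not_1_2:
  fixes a c :: "'a::{finite,ab_group_add}"
  assumes three: "\<And>v :: 'a. v + v + v = 0" and "rooted_counts a c x z"
    and "x + z + 3 = CARD('a)" and "x mod 3 = 1" "z mod 3 = 2"
  shows False
proof -
  obtain P R where PR: "step_pair a c {0} P R" "(P \<union> R) \<inter> {0, a, c} = {}" "card P = x" "card R = z"
    and ne: "a \<noteq> 0" "c \<noteq> 0" "a \<noteq> c" using assms(2) unfolding rooted_counts_def by blast
  have disj: "P \<inter> R = {}" "(+) a ` P \<inter> (+) c ` R = {}"
    and sub: "(+) a ` P \<union> (+) c ` R \<subseteq> insert 0 (P \<union> R)"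
    using PR(1) by (auto simp: step_pair_def)
  have double: "v + v = - v" for v :: 'a using three[of v] by (simp add: eq_neg_iff_add_eq_0)
  have "card (P \<union> R \<union> {0, a, c}) = CARD('a)"
    using PR(2-4) disj(1) ne assms(3) by (simp add: card_Un_disjoint)
  then have UNIV: "v \<in> P \<union> R \<union> {0, a, c}" for v
    by (metis UNIV_I card_subset_eq finite subset_UNIV)
  obtain m where m: "m \<in> insert 0 (P \<union> R)" "m + (\<Sum>v\<in>P. a) + (\<Sum>v\<in>R. c) = 0"
    using step_pair_root_image[OF PR(1)] PR(2) by auto
  have "(\<Sum>v\<in>P. a) = a" "(\<Sum>v\<in>R. c) = c + c"
    using sum_const_mod_3[OF three, of P a] sum_const_mod_3[OF three, of R c] PR assms
    by (simp_all add: numeral_2_eq_2)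
  with m(2) have "m + a - c = 0" by (simp add: double)
  then have "m = c - a" by (simp add: algebra_simps)
  show False
  proof (cases "c = - a")
    case True
    then have "m = a" using \<open>m = c - a\<close> double[of "-a"] by simp
    then show False using m(1) PR(2) ne by auto
  next
    case False
    \<comment> \<open>Since \<open>a + a = - a\<close> and \<open>c + c = - c\<close>, either
      equality would give \<open>c = - a\<close>.\<close>
    have "c - a \<noteq> a" using False by (metis double diff_eq_eq)
    moreover have "a - c \<noteq> c" using False by (metis double diff_eq_eq minus_minus)
    ultimately have in1: "c - a \<in> P \<union> R" and in2: "a - c \<in> P \<union> R"
      using UNIV[of "c - a"] UNIV[of "a - c"] ne by (auto simp: algebra_simps)
    \<comment> \<open>A step by \<open>a\<close> from \<open>c - a\<close> would land on the spine
      label \<open>c\<close>, so \<open>c - a\<close> must step by \<open>c\<close>; symmetrically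
      for \<open>a - c\<close>.\<close>
    have "a + (c - a) \<notin> (+) a ` P" using sub PR(2) ne by auto
    then have "c - a \<in> R" using in1 by blast
    have "c + (a - c) \<notin> (+) c ` R" using sub PR(2) ne by auto
    then have "a - c \<in> P" using in2 by blast
    have "a + (a - c) = c + (c - a)"
      using double[of a] double[of c] by (simp add: algebra_simps)
    then show False using disj(2) \<open>c - a \<in> R\<close> \<open>a - c \<in> P\<close> by blast
  qed
qed

section \<open>Constructions in the elementary abelian 3-group\<close>

text \<open>Greedy choice: a block takes three units, from \<open>p\<close> first, or everything
  that is left. A block will become a coset of order 9, and a unit three equal steps.\<close>

lemma split_into_triples:
  fixes p q n :: nat
  assumes "p + q \<le> 3 * n"
  shows "\<exists>ps. length ps = n \<and> (\<forall>(i, j)\<in>set ps. i + j \<le> 3) \<and>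
    sum_list (map fst ps) = p \<and> sum_list (map snd ps) = q"
  using assms
proof (induction n arbitrary: p q)
  case (Suc n)
  define i where "i = min p 3"
  define j where "j = min q (3 - i)"
  have "p - i + (q - j) \<le> 3 * n" using Suc.prems by (auto simp: i_def j_def)
  from Suc.IH[OF this] obtain ps where "length ps = n" "\<forall>(i, j)\<in>set ps. i + j \<le> 3"
    "sum_list (map fst ps) = p - i" "sum_list (map snd ps) = q - j" by blast
  moreover have "i \<le> p" "j \<le> q" "i + j \<le> 3" unfolding i_def j_def by arith+
  ultimately show ?case by (intro exI[of _ "(i, j) # ps"]) auto
qed auto

lemma additive_axis:
  fixes i :: "'k::finite"
  shows "axis i (u + v) = axis i u + (axis i v :: 'b::ab_group_add ^ 'k)"
  by (simp add: vec_eq_iff axis_def)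

lemma CARD_Z3_power:
  obtains n where "CARD(3 ^ 'k::finite) = 3 * n"
proof -
  obtain m where "CARD('k) = Suc m" using not0_implies_Suc[of "CARD('k)"] by auto
  then show ?thesis using that[of "3 ^ m"] by simp
qed

lemma CARD_Z3_power_ge_2:
  assumes "1 < CARD('k::finite)"
  obtains n where "CARD(3 ^ 'k) = 9 * n"
proof -
  obtain m where "CARD('k) = Suc (Suc m)" using assms less_natE[of 1 "CARD('k)"] by auto
  then show ?thesis using that[of "3 ^ m"] by simp
qed

text \<open>With \<open>c = - a\<close>, the common residue is realized by 2-cycles and the rest by
  triangles, one pattern per coset of the line spanned by \<open>a\<close>.\<close>

lemma rooted_counts_opposite:
  assumes "x + z + 3 \<le> CARD(3 ^ 'k::finite)" and "x mod 3 = z mod 3"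
  shows "\<exists>a c :: 3 ^ 'k. rooted_counts a c x z"
proof -
  obtain i :: 'k where True by blast
  define ps :: "(nat \<times> nat) list" where
    "ps = replicate (x div 3) (3, 0) @ replicate (z div 3) (0, 3) @ replicate (x mod 3) (1, 1)"
  have closed: "closed_counts (1::3) 2 (fst p) (snd p)" if "p \<in> set ps" for p
    using that closed_counts_Z3 by (auto simp: ps_def split: if_splits)
  obtain n where n: "CARD(3 ^ 'k) = 3 * n" by (rule CARD_Z3_power)
  have "Suc (length ps) \<le> n"
  proof -
    define p q r where "p = x div 3" and "q = z div 3" and "r = x mod 3"
    have xz: "x = 3 * p + r" "z = 3 * q + r" and "r < 3"
      using assms(2) unfolding p_def q_def r_def by (metis mult_div_mod_eq, metis mult_div_mod_eq, simp)
    have "3 * (p + q) + 2 * r + 3 \<le> 3 * n" using assms(1) unfolding n xz by simp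
    \<comment> \<open>A 2-cycle occupies a whole coset but uses two of its points. Nothing is lost,
      since \<open>2 * r / 3\<close> rounds up to \<open>r\<close> for \<open>r < 3\<close>; the
      \<open>1\<close> is the subgroup.\<close>
    then have "p + q + r + 1 \<le> n" using \<open>r < 3\<close> by arith
    then show ?thesis by (simp add: ps_def p_def q_def r_def)
  qed
  then have "Suc (length ps) * CARD(3) \<le> CARD(3 ^ 'k)" unfolding n by simp
  then have "rooted_counts (axis i (1::3)) (axis i 2)
      (0 + sum_list (map fst ps)) (0 + sum_list (map snd ps))"
    using closed by (intro rooted_counts_extend[OF additive_axis _ rooted_counts_Z3])
      (auto simp: inj_def axis_eq_axis)
  moreover have "sum_list (map fst ps) = x" by (simp add: ps_def sum_list_replicate)
  moreover have "sum_list (map snd ps) = z"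
    using assms(2) by (simp add: ps_def sum_list_replicate)
  ultimately show ?thesis by auto
qed

text \<open>Two coordinate axes embed the square. The root pattern takes the 9 points of its image,
  and every other coset absorbs up to three triples of steps in any mix.\<close>

lemma rooted_counts_independent:
  fixes x0 z0 p q :: nat
  assumes root: "rooted_counts (1 :: 3, 0 :: 3) (0, 1) x0 z0"
    and "3 * (p + q) + 9 \<le> CARD(3 ^ 'k::finite)" and "1 < CARD('k)"
  shows "\<exists>a c :: 3 ^ 'k. rooted_counts a c (x0 + 3 * p) (z0 + 3 * q)"
proof -
  obtain i j :: 'k where "i \<noteq> j"
    using assms(3) card_le_Suc0_iff_eq[of "UNIV :: 'k set"] by auto
  define g :: "3 \<times> 3 \<Rightarrow> 3 ^ 'k" where "g u = axis i (fst u) + axis j (snd u)" for u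
  have add: "g (u + v) = g u + g v" for u v by (simp add: g_def additive_axis)
  have "g u $ i = fst u" "g u $ j = snd u" for u
    using \<open>i \<noteq> j\<close> by (simp_all add: g_def axis_def)
  then have "inj g" by (metis injI prod.expand)
  obtain k where k: "CARD(3 ^ 'k) = 9 * k" by (rule CARD_Z3_power_ge_2[OF assms(3)])
  then have "p + q \<le> 3 * (k - 1)" "k \<ge> 1" using assms(2) by auto
  then obtain qs where qs: "length qs = k - 1" "\<forall>(i, j)\<in>set qs. i + j \<le> 3"
    "sum_list (map fst qs) = p" "sum_list (map snd qs) = q"
    using split_into_triples by blast
  define ps where "ps = map (\<lambda>(i, j). (3 * i, 3 * j)) qs"
  have "closed_counts (1 :: 3, 0 :: 3) (0, 1) (fst r) (snd r)" if "r \<in> set ps" for r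
    using that qs(2) closed_counts_Z3_square by (auto simp: ps_def)
  moreover have "Suc (length ps) * CARD(3 \<times> 3) \<le> CARD(3 ^ 'k)"
    using qs(1) \<open>k \<ge> 1\<close> unfolding k by (simp add: ps_def)
  ultimately have "rooted_counts (g (1, 0)) (g (0, 1))
      (x0 + sum_list (map fst ps)) (z0 + sum_list (map snd ps))"
    by (intro rooted_counts_extend[OF add \<open>inj g\<close> root]) auto
  moreover have "sum_list (map fst ps) = 3 * p" "sum_list (map snd ps) = 3 * q"
    unfolding qs(3,4)[symmetric] sum_list_const_mult[symmetric]
    by (simp_all add: ps_def case_prod_beta comp_def)
  ultimately show ?thesis by auto
qed

text \<open>The one-step path suffices if the outer cosets have room for all triples. Otherwise
  exactly one triple is too many, and it moves into the subgroup: counts \<open>(3, 1)\<close> if it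
  consists of steps by \<open>a\<close>, \<open>(0, 4)\<close> if of steps by
  \<open>c\<close>.\<close>

lemma rooted_counts_0_1:
  assumes "x + z + 3 \<le> CARD(3 ^ 'k::finite)" and "1 < CARD('k)" and "x mod 3 = 0" "z mod 3 = 1"
  shows "\<exists>a c :: 3 ^ 'k. rooted_counts a c x z"
proof -
  define p q where "p = x div 3" and "q = z div 3"
  have xz: "x = 3 * p" "z = 1 + 3 * q" using assms(3,4) unfolding p_def q_def by presburger+
  obtain k where k: "CARD(3 ^ 'k) = 9 * k" by (rule CARD_Z3_power_ge_2[OF assms(2)])
  \<comment> \<open>Divisibility by 3 improves the bound from 4 to 6.\<close>
  have le: "3 * (p + q) + 6 \<le> 9 * k" using assms(1) unfolding xz k by presburger
  note extend = rooted_counts_independent[OF _ _ assms(2)]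
  consider "3 * (p + q) + 9 \<le> 9 * k" | "p > 0" | "p = 0" "q > 0" | "p = 0" "q = 0" "k = 0"
    using le by (cases "p = 0"; cases "q = 0"; cases "k = 0") auto
  then show ?thesis
  proof cases
    case 1
    then show ?thesis using extend[OF rooted_counts_Z3_square(1), of p q] k xz by auto
  next
    case 2
    then show ?thesis using extend[OF rooted_counts_Z3_square(3), of "p - 1" q] k xz le
      by (auto simp: algebra_simps)
  next
    case 3
    then show ?thesis using extend[OF rooted_counts_Z3_square(2), of p "q - 1"] k xz le
      by (auto simp: algebra_simps)
  next
    case 4
    then show ?thesis using le by simp
  qed
qed

text \<open>Both sides of the strict inequality are divisible by 3, so three labels are spare; the
  path with counts \<open>(1, 2)\<close> then leaves the outer cosets enough room.\<close>

lemma rooted_counts_1_2: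
  assumes "x + z + 3 < CARD(3 ^ 'k::finite)" and "1 < CARD('k)" and "x mod 3 = 1" "z mod 3 = 2"
  shows "\<exists>a c :: 3 ^ 'k. rooted_counts a c x z"
proof -
  define p q where "p = x div 3" and "q = z div 3"
  have xz: "x = 1 + 3 * p" "z = 2 + 3 * q" using assms(3,4) unfolding p_def q_def by presburger+
  obtain n where n: "CARD(3 ^ 'k) = 3 * n" by (rule CARD_Z3_power)
  have "3 * (p + q) + 9 \<le> CARD(3 ^ 'k)" using assms(1) unfolding xz n by presburger
  then show ?thesis
    using rooted_counts_independent[OF rooted_counts_Z3_square(4) _ assms(2)] xz by auto
qed

text \<open>Equality in \<open>le\<close> is the case of no leaves at the middle vertex. Exchanging
  the ends of the spine halves the residue cases in both directions.\<close>

lemma rooted_counts_iff: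
  assumes le: "x + z + 3 \<le> CARD(3 ^ 'k::finite)" and k: "1 < CARD('k)"
  shows "(\<exists>a c :: 3 ^ 'k. rooted_counts a c x z) \<longleftrightarrow>
    \<not> (x mod 3 = 0 \<and> z mod 3 = 2 \<or> x mod 3 = 2 \<and> z mod 3 = 0) \<and>
    \<not> (x + z + 3 = CARD(3 ^ 'k) \<and>
        (x mod 3 = 1 \<and> z mod 3 = 2 \<or> x mod 3 = 2 \<and> z mod 3 = 1))" (is "?L \<longleftrightarrow> ?R")
proof
  have three: "v + v + v = 0" for v :: "3 ^ 'k" 
    by (simp only: vec_eq_iff vector_add_component zero_index Z3_triple) simp
  assume ?L
  then obtain a c :: "3 ^ 'k" where 1: "rooted_counts a c x z" by blast
  then have 2: "rooted_counts c a z x" by (simp add: rooted_counts_commute)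
  show ?R
    using rooted_counts_not_0_2[OF three 1] rooted_counts_not_0_2[OF three 2]
      rooted_counts_spanning_not_1_2[OF three 1] rooted_counts_spanning_not_1_2[OF three 2]
    by (auto simp: add.commute simp del: CARD_vec)
next
  assume ?R
  have swap: ?L if "\<exists>a c :: 3 ^ 'k. rooted_counts a c z x" 
    using that rooted_counts_commute by blast
  have "x mod 3 = 0 \<or> x mod 3 = 1 \<or> x mod 3 = 2" "z mod 3 = 0 \<or> z mod 3 = 1 \<or> z mod 3 = 2"
    by presburger+
  moreover have "x + z + 3 = CARD(3 ^ 'k) \<or> x + z + 3 < CARD(3 ^ 'k)"
    using le by (metis order_le_less)
  ultimately consider "x mod 3 = z mod 3" | "x mod 3 = 0" "z mod 3 = 1" | "x mod 3 = 1" "z mod 3 = 0"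
    | "x mod 3 = 1" "z mod 3 = 2" "x + z + 3 < CARD(3 ^ 'k)"
    | "x mod 3 = 2" "z mod 3 = 1" "x + z + 3 < CARD(3 ^ 'k)"
    using \<open>?R\<close> by (elim disjE) (simp_all del: CARD_vec)
  then show ?L
  proof cases
    case 1
    then show ?thesis using rooted_counts_opposite le by blast
  next
    case 2
    then show ?thesis by (intro rooted_counts_0_1[OF le k])
  next
    case 3
    then show ?thesis using rooted_counts_0_1[of z x] le k by (intro swap) (simp add: add.commute)
  next
    case 4
    then show ?thesis using rooted_counts_1_2 k by blast
  next
    case 5
    then show ?thesis using rooted_counts_1_2[of z x] k by (intro swap) (simp add: add.commute)
  qed
qed

section \<open>Labelings of a tree with a three-vertex spine, rooted at the middle\<close>

lemma inj_on_UnI: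
  assumes "inj_on f A" "inj_on f B" "f ` A \<inter> f ` B = {}"
  shows "inj_on f (A \<union> B)"
  using assms unfolding inj_on_Un by blast

locale three_vertex_spine =
  fixes V X Y Z :: "'v set" and s1 s2 s3 :: 'v
  assumes finite_V: "finite V"
    and V_eq: "V = {s1, s2, s3} \<union> X \<union> Y \<union> Z"
    and spine: "distinct [s1, s2, s3]"
    and disjoint: "X \<inter> Y = {}" "X \<inter> Z = {}" "Y \<inter> Z = {}"
    and leaves: "{s1, s2, s3} \<inter> (X \<union> Y \<union> Z) = {}"
begin

text \<open>The default \<open>s2\<close> serves \<open>Y\<close>, \<open>s1\<close> and
  \<open>s3\<close>; the root has no parent and is excluded by \<open>V - {s2}\<close>. Each edge is
  thus indexed by its lower end.\<close>

definition parent :: "'v \<Rightarrow> 'v" where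
  "parent v = (if v \<in> X then s1 else if v \<in> Z then s3 else s2)"

definition edges :: "'v set set" where
  "edges = (\<lambda>v. {v, parent v}) ` (V - {s2})"

lemma parent_simps:
  "v \<in> X \<Longrightarrow> parent v = s1" "v \<in> Y \<Longrightarrow> parent v = s2" "v \<in> Z \<Longrightarrow> parent v = s3"
  "parent s1 = s2" "parent s3 = s2"
  using disjoint leaves by (auto simp: parent_def)

lemma non_root_eq: "V - {s2} = (X \<union> Z) \<union> (Y \<union> {s1, s3})"
  using V_eq spine leaves by auto

lemma parent_neq: "v \<in> V - {s2} \<Longrightarrow> parent v \<noteq> v"
  using spine leaves unfolding non_root_eq by (auto simp: parent_simps)

lemma inj_edge_above: "inj_on (\<lambda>v. {v, parent v}) (V - {s2})"
proof
  fix v w assume "v \<in> V - {s2}" "w \<in> V - {s2}" "{v, parent v} = {w, parent w}"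
  then show "v = w"
    using spine leaves unfolding non_root_eq by (auto simp: parent_simps doubleton_eq_iff)
qed

lemma card_V: "card V = card X + card Y + card Z + 3"
proof -
  have fin: "finite X" "finite Y" "finite Z" using finite_V V_eq by simp_all
  have "card V = card {s1, s2, s3} + card (X \<union> Y \<union> Z)"
    unfolding V_eq Un_assoc using fin leaves by (intro card_Un_disjoint) auto
  also have "card (X \<union> Y \<union> Z) = card X + card Y + card Z"
    using fin disjoint by (simp add: card_Un_disjoint Int_Un_distrib2)
  finally show ?thesis using spine by simp
qed

lemma rainbow_labeling_iff:
  "rainbow_labeling V edges f \<longleftrightarrow>
    bij_betw f V UNIV \<and> inj_on (\<lambda>v. f v + f (parent v)) (V - {s2})"
proof -
  have "inj_on (\<lambda>e. sum f e) edges \<longleftrightarrow> inj_on ((\<lambda>e. sum f e) \<circ> (\<lambda>v. {v, parent v})) (V - {s2})"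
    unfolding edges_def by (rule comp_inj_on_iff[OF inj_edge_above])
  also have "\<dots> \<longleftrightarrow> inj_on (\<lambda>v. f v + f (parent v)) (V - {s2})"
    using parent_neq[THEN not_sym] by (intro inj_on_cong) simp
  finally show ?thesis unfolding rainbow_labeling_def by simp
qed

lemma rainbow_iff_rooted_counts:
  assumes card: "card V = CARD('a::{finite,ab_group_add})"
  shows "rainbow TYPE('a) V edges \<longleftrightarrow> (\<exists>a c :: 'a. rooted_counts a c (card X) (card Z))"
proof
  assume "rainbow TYPE('a) V edges"
  then obtain f :: "'v \<Rightarrow> 'a" where f: "bij_betw f V UNIV"
    and f_edge: "inj_on (\<lambda>v. f v + f (parent v)) (V - {s2})"
    unfolding rainbow_def rainbow_labeling_iff by blast
  \<comment> \<open>Translation moves the root label to \<open>0\<close> and shifts all edge labels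
    by one constant.\<close>
  define h where "h v = f v - f s2" for v
  have h_inj: "inj_on h V" using f by (auto simp: bij_betw_def inj_on_def h_def)
  have h_surj: "\<exists>w\<in>V. h w = t" for t
  proof -
    have "t + f s2 \<in> f ` V" using f by (simp add: bij_betw_def)
    then obtain w where "w \<in> V" "f w = t + f s2" by auto
    then show ?thesis by (auto simp: h_def intro!: bexI[of _ w])
  qed
  have edge_inj: "v = w" if "v \<in> V - {s2}" "w \<in> V - {s2}"
      "h v + h (parent v) = h w + h (parent w)" for v w
    using that f_edge by (auto simp: inj_on_def h_def algebra_simps)
  have h_root: "h s2 = 0" by (simp add: h_def)
  have into: "h v + h (parent v) \<in> h ` (X \<union> Z \<union> {s2})" if "v \<in> X \<union> Z" for v
  proof -
    obtain w where w: "w \<in> V" "h w = h v + h (parent v)" using h_surj by metis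
    \<comment> \<open>For a child \<open>w\<close> of the root, the edge above \<open>w\<close> has
      label \<open>h w\<close>, which is already the label of the edge above
      \<open>v\<close>.\<close>
    have "w \<notin> Y \<union> {s1, s3}"
    proof
      assume "w \<in> Y \<union> {s1, s3}"
      then have "w \<in> V - {s2}" "parent w = s2" by (auto simp: non_root_eq parent_simps)
      then have "v = w" using that edge_inj[of v w] w by (simp add: non_root_eq h_root)
      then show False using \<open>w \<in> Y \<union> {s1, s3}\<close> that disjoint leaves by auto
    qed
    then show ?thesis using w V_eq
      by (metis (no_types, lifting) image_eqI non_root_eq DiffI UnE UnI1 UnI2 singletonD singletonI)
  qed
  have "step_pair (h s1) (h s3) {0} (h ` X) (h ` Z)"
    unfolding step_pair_def
  proof (intro conjI)
    show "h ` X \<inter> h ` Z = {}"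
      using inj_on_image_Int[OF h_inj, of X Z] disjoint(2) by (auto simp: V_eq)
    have False if "v \<in> X" "w \<in> Z" "h s1 + h v = h s3 + h w" for v w
      using that edge_inj[of v w] disjoint(2)
      by (auto simp: non_root_eq parent_simps add.commute)
    then show "(+) (h s1) ` h ` X \<inter> (+) (h s3) ` h ` Z = {}" by auto
    have "h s1 + h v \<in> h ` X \<union> h ` Z \<union> {0}" if "v \<in> X" for v
      using into[of v] that h_root by (auto simp: parent_simps add.commute)
    moreover have "h s3 + h v \<in> h ` X \<union> h ` Z \<union> {0}" if "v \<in> Z" for v
      using into[of v] that h_root by (auto simp: parent_simps add.commute)
    ultimately show "(+) (h s1) ` h ` X \<union> (+) (h s3) ` h ` Z \<subseteq> h ` X \<union> h ` Z \<union> {0}" by auto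
  qed
  moreover have "(h ` X \<union> h ` Z) \<inter> {0, h s1, h s3} = {}"
  proof -
    have "h ` (X \<union> Z) \<inter> h ` {s1, s2, s3} = h ` ((X \<union> Z) \<inter> {s1, s2, s3})"
      by (rule inj_on_image_Int[OF h_inj, symmetric]) (auto simp: V_eq)
    also have "(X \<union> Z) \<inter> {s1, s2, s3} = {}" using leaves by auto
    finally show ?thesis using h_root by (simp add: image_Un insert_commute)
  qed
  moreover have "h s1 \<noteq> 0" "h s3 \<noteq> 0" "h s1 \<noteq> h s3"
    using h_inj V_eq spine h_root by (auto simp: inj_on_def)
  moreover have "card (h ` X) = card X" "card (h ` Z) = card Z"
    by (rule card_image, rule inj_on_subset[OF h_inj], auto simp: V_eq)+
  ultimately show "\<exists>a c :: 'a. rooted_counts a c (card X) (card Z)"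
    unfolding rooted_counts_def by blast
next
  assume "\<exists>a c :: 'a. rooted_counts a c (card X) (card Z)"
  then obtain a c :: 'a and P R where ne: "a \<noteq> 0" "c \<noteq> 0" "a \<noteq> c"
    and step: "step_pair a c {0} P R"
    and avoid: "(P \<union> R) \<inter> {0, a, c} = {}" and cards: "card P = card X" "card R = card Z"
    unfolding rooted_counts_def by blast
  have disj: "P \<inter> R = {}" "(+) a ` P \<inter> (+) c ` R = {}"
    and sub: "(+) a ` P \<union> (+) c ` R \<subseteq> P \<union> R \<union> {0}"
    using step by (simp_all add: step_pair_def)
  define Q where "Q = - (P \<union> R \<union> {0, a, c})"
  have fin: "finite X" "finite Y" "finite Z" using finite_V V_eq by simp_all
  have "card (P \<union> R \<union> {0, a, c}) = card X + card Z + 3"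
    using avoid disj(1) ne cards by (simp add: card_Un_disjoint)
  then have "card Q = card Y" using card card_V by (simp add: Q_def Compl_eq_Diff_UNIV card_Diff_subset)
  with cards fin obtain fX fY fZ where bij: "bij_betw fX X P" "bij_betw fY Y Q" "bij_betw fZ Z R"
    using finite_same_card_bij by (metis finite)
  define f where "f v = (if v \<in> X then fX v else if v \<in> Y then fY v else if v \<in> Z then fZ v
    else if v = s1 then a else if v = s3 then c else 0)" for v
  have f_spine: "f s1 = a" "f s2 = 0" "f s3 = c"
    using leaves spine by (auto simp: f_def)
  have "f ` X = fX ` X" "f ` Y = fY ` Y" "f ` Z = fZ ` Z"
    using disjoint by (auto simp: f_def intro!: image_cong)
  then have f_image: "f ` X = P" "f ` Y = Q" "f ` Z = R" using bij by (simp_all add: bij_betw_def)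
  have f_surj: "f ` V = UNIV"
    unfolding V_eq image_Un f_image by (auto simp: f_spine Q_def)
  then have f_inj: "inj_on f V" using finite_V card by (intro eq_card_imp_inj_on) simp_all
  let ?e = "\<lambda>v. f v + f (parent v)"
  have e_low: "?e v = f v" if "v \<in> Y \<union> {s1, s3}" for v
    using that by (auto simp: parent_simps f_spine)
  have eX: "?e v = a + f v" if "v \<in> X" for v using that by (simp add: parent_simps f_spine add.commute)
  have eZ: "?e v = c + f v" if "v \<in> Z" for v using that by (simp add: parent_simps f_spine add.commute)
  have e_image: "?e ` X = (+) a ` P" "?e ` Z = (+) c ` R"
    unfolding f_image[symmetric] image_image using eX eZ by (intro image_cong; simp)+
  have inj_X: "inj_on ?e X"
    using f_inj eX V_eq by (auto simp: inj_on_def)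
  have inj_Z: "inj_on ?e Z"
    using f_inj eZ V_eq by (auto simp: inj_on_def)
  have "inj_on ?e (X \<union> Z)"
    using inj_X inj_Z disj(2) unfolding e_image[symmetric] by (rule inj_on_UnI)
  moreover have "inj_on ?e (Y \<union> {s1, s3})"
  proof -
    have "inj_on f (Y \<union> {s1, s3})" using f_inj by (rule inj_on_subset) (auto simp: V_eq)
    then show ?thesis using inj_on_cong[of "Y \<union> {s1, s3}" ?e f] e_low by blast
  qed
  moreover have "?e ` (X \<union> Z) \<inter> ?e ` (Y \<union> {s1, s3}) = {}"
  proof -
    have "?e ` (Y \<union> {s1, s3}) = f ` (Y \<union> {s1, s3})" using e_low by (intro image_cong) simp_all
    also have "\<dots> = Q \<union> {a, c}" by (simp add: image_Un f_image f_spine)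
    finally have "?e ` (Y \<union> {s1, s3}) = Q \<union> {a, c}" .
    moreover have "?e ` (X \<union> Z) \<subseteq> P \<union> R \<union> {0}" using sub by (simp add: image_Un e_image)
    then have "?e ` (X \<union> Z) \<inter> (Q \<union> {a, c}) \<subseteq> (P \<union> R \<union> {0}) \<inter> (Q \<union> {a, c})"
      by (rule Int_mono) simp
    moreover have "(P \<union> R \<union> {0}) \<inter> (Q \<union> {a, c}) = {}" using avoid ne by (auto simp: Q_def)
    ultimately show ?thesis by (simp only: subset_empty)
  qed
  ultimately have "inj_on ?e (V - {s2})"
    unfolding non_root_eq by (rule inj_on_UnI)
  then show "rainbow TYPE('a) V edges"
    using f_inj f_surj unfolding rainbow_def rainbow_labeling_iff bij_betw_def by blast
qed

end

section \<open>From caterpillars to the rooted description\<close>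

lemma leaf_edges_eq:
  assumes "leaf V E v" "e \<in> E" "v \<in> e" "e' \<in> E" "v \<in> e'"
  shows "e = e'"
proof -
  obtain d where d: "{e \<in> E. v \<in> e} = {d}"
    using assms(1) unfolding leaf_def by (meson card_1_singletonE)
  have "e \<in> {e \<in> E. v \<in> e}" "e' \<in> {e \<in> E. v \<in> e}" using assms(2-) by simp_all
  then show ?thesis unfolding d by simp
qed

lemma caterpillar_three_vertex_spine:
  assumes cat: "caterpillar_with_spine V E [s1, s2, s3]"
    and X: "X = leaves_attached V E [s1, s2, s3] s1"
    and Y: "Y = leaves_attached V E [s1, s2, s3] s2"
    and Z: "Z = leaves_attached V E [s1, s2, s3] s3"
  shows "three_vertex_spine V X Y Z s1 s2 s3"
    and "E = three_vertex_spine.edges V X Z s1 s2 s3"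
proof -
  have graph: "finite V" "\<And>e. e \<in> E \<Longrightarrow> e \<subseteq> V \<and> card e = 2" "\<And>p. \<not> graph_cycle V E p"
    using cat by (auto simp: caterpillar_with_spine_def tree_def simple_graph_def)
  have path: "simple_path V E [s1, s2, s3]"
    and attached: "\<And>v. v \<in> V - {s1, s2, s3} \<Longrightarrow>
      leaf V E v \<and> ({s1, v} \<in> E \<or> {s2, v} \<in> E \<or> {s3, v} \<in> E)"
    using cat by (auto simp: caterpillar_with_spine_def)
  have spine: "distinct [s1, s2, s3]" "{s1, s2, s3} \<subseteq> V" and spine_edges: "{s1, s2} \<in> E" "{s2, s3} \<in> E"
    using path by (force simp: simple_path_def walk_def less_Suc_eq)+
  \<comment> \<open>The chord would close the spine to a triangle.\<close>
  have no_chord: "{s1, s3} \<notin> E"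
    using graph(3)[of "[s1, s2, s3]"] path by (simp add: graph_cycle_def insert_commute)
  have mem: "v \<in> X \<longleftrightarrow> v \<in> V - {s1, s2, s3} \<and> {s1, v} \<in> E"
    "v \<in> Y \<longleftrightarrow> v \<in> V - {s1, s2, s3} \<and> {s2, v} \<in> E"
    "v \<in> Z \<longleftrightarrow> v \<in> V - {s1, s2, s3} \<and> {s3, v} \<in> E" for v
    using attached by (auto simp: X Y Z leaves_attached_def)
  have unique: "s = t" if "v \<in> V - {s1, s2, s3}" "{s, v} \<in> E" "{t, v} \<in> E" for v s t
    using leaf_edges_eq[of V E v "{s, v}" "{t, v}"] attached that by (auto simp: doubleton_eq_iff)
  show sp: "three_vertex_spine V X Y Z s1 s2 s3"
  proof
    show "V = {s1, s2, s3} \<union> X \<union> Y \<union> Z"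
    proof
      show "V \<subseteq> {s1, s2, s3} \<union> X \<union> Y \<union> Z"
        using attached by (fastforce simp: mem)
      show "{s1, s2, s3} \<union> X \<union> Y \<union> Z \<subseteq> V"
        using spine(2) by (auto simp: mem)
    qed
    show "X \<inter> Y = {}" "X \<inter> Z = {}" "Y \<inter> Z = {}"
      using unique[of _ s1 s2] unique[of _ s1 s3] unique[of _ s2 s3] spine(1)
      unfolding disjoint_iff mem by simp_all blast+
  qed (use graph(1) spine in \<open>auto simp: mem\<close>)
  interpret three_vertex_spine V X Y Z s1 s2 s3 by (rule sp)
  show "E = edges"
  proof
    show sub: "edges \<subseteq> E"
      unfolding edges_def non_root_eq using spine_edges
      by (auto simp: parent_simps mem insert_commute)
    show "E \<subseteq> edges"
    proof
      fix e assume e: "e \<in> E"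
      have child: "{v, parent v} \<in> edges" if "v \<in> V - {s2}" for v
        using that by (auto simp: edges_def)
      obtain u v where uv: "e = {u, v}" "u \<noteq> v" "u \<in> V" "v \<in> V"
        using graph(2)[OF e] by (auto simp: card_2_iff)
      have leaf_case: "e \<in> edges" if "w \<in> V - {s1, s2, s3}" "w \<in> e" for w
      proof -
        have "{w, parent w} \<in> edges" using child that(1) by simp
        \<comment> \<open>A leaf has only one edge, and the edge to its parent is one.\<close>
        moreover have "e = {w, parent w}"
          using leaf_edges_eq[of V E w e "{w, parent w}"] attached[OF that(1)] that(2) e sub calculation
          by (meson insertI1 subsetD)
        ultimately show ?thesis by simp
      qed
      show "e \<in> edges"
      proof (cases "e \<subseteq> {s1, s2, s3}")
        case True
        then have "e = {s1, s2} \<or> e = {s3, s2}"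
          using uv e no_chord by (auto simp: insert_commute)
        moreover have "s1 \<in> V" "s3 \<in> V" using V_eq by auto
        ultimately show ?thesis
          using child[of s1] child[of s3] spine by (auto simp: parent_simps)
      next
        case False
        then show ?thesis using leaf_case graph(2)[OF e] by blast
      qed
    qed
  qed
qed

theorem theorem6:
  fixes V :: "'v set" and E :: "'v set set" and s1 s2 s3 :: 'v and X Y Z :: "'v set" and k :: nat
  assumes "k = CARD('k::finite)" and "k > 1"
    and "caterpillar_with_spine V E [s1, s2, s3]"
    and "card V = 3 ^ k"
    and "X = leaves_attached V E [s1, s2, s3] s1"
    and "Y = leaves_attached V E [s1, s2, s3] s2"
    and "Z = leaves_attached V E [s1, s2, s3] s3"
  shows "rainbow TYPE('k Z3_power) V E \<longleftrightarrow>
    \<not> ((card X mod 3 = 0 \<and> card Z mod 3 = 2) \<or> (card X mod 3 = 2 \<and> card Z mod 3 = 0)) \<and>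
    \<not> (card Y = 0 \<and>
        ((card X mod 3 = 1 \<and> card Z mod 3 = 2) \<or> (card X mod 3 = 2 \<and> card Z mod 3 = 1)))"
proof -
  interpret three_vertex_spine V X Y Z s1 s2 s3
    by (rule caterpillar_three_vertex_spine(1)[OF assms(3,5-7)])
  have E: "E = edges" by (rule caterpillar_three_vertex_spine(2)[OF assms(3,5-7)])
  have card: "card V = CARD('k Z3_power)" using assms(1,4) by simp
  then have "card X + card Z + 3 \<le> CARD('k Z3_power)"
    and full: "card X + card Z + 3 = CARD('k Z3_power) \<longleftrightarrow> card Y = 0"
    using card_V by linarith+
  then show ?thesis
    unfolding E rainbow_iff_rooted_counts[OF card] full[symmetric]
    using assms(1,2) by (intro rooted_counts_iff) simp_all
qed

end
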